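(* For all integers $n\geq 1$ and $k\geq 1$ with $k\neq n+1$, $$C(n+1,k)=\sum_{i\geq 1}\binom{k+2i}{k-1}\frac{C(n+1,k+2i)}{n+1-k}+\binom{n+1}{2}\frac{C(n,k)}{n+1-k}.$$
   Context: $C(m,k)$ denotes the unsigned Stirling number of the first kind, i.e. the number of permutations of $[m]=\{1,\dots,m\}$ with exactly $k$ cycles (fixed points count as cycles; $C(m,k)=0$ if $k>m$). *)

theory Defs
  imports
    "HOL-Analysis.Infinite_Sum"
    "HOL-Combinatorics.Orbits"
    "HOL-Combinatorics.Stirling"
begin

(* Cycles are represented by their underlying sets: the orbits of p on {1..m}. *)
definition C :: "nat \<Rightarrow> nat \<Rightarrow> nat" where
  "C m k = card {p. p permutes {1..m} \<and> card (orbit p ` {1..m}) = k}"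

lemma card_orbits_fixpoint:
  assumes "p permutes S" "finite S" "a \<notin> S"
  shows "card (orbit p ` insert a S) = Suc (card (orbit p ` S))"
proof -
  have "orbit p a = {a}"
    using assms by (simp add: orbit_eq_singleton_iff permutes_not_in)
  moreover have "{a} \<notin> orbit p ` S"
    using permutes_orbit_subset[OF assms(1)] assms(3) by blast
  ultimately show ?thesis using assms(2) by simp
qed

lemma card_orbits_insert:
  assumes "p permutes S" "finite S" "a \<notin> S" "b \<in> S"
  shows "card (orbit (transpose a b \<circ> p) ` insert a S) = card (orbit p ` S)"
proof -
  define q where "q = transpose a b \<circ> p"
  define F where "F = (\<lambda>X. if b \<in> X then insert a X else X)"
  have "q permutes insert a S"
    unfolding q_def using assms
    by (intro permutes_compose permutes_subset[OF assms(1)] permutes_swap_id) auto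
  then have perm: "permutation q"
    using assms(2) by (auto simp: permutation_permutes)
  have pS: "p x \<in> S" if "x \<in> S" for x
    using that assms(1) by (simp add: permutes_in_image)
  have qa: "q a = b"
    using assms by (simp add: q_def permutes_not_in)
  have qS: "q x = (if p x = b then a else p x)" if "x \<in> S" for x
    using pS[OF that] assms(3) by (auto simp: q_def transpose_def)
  have orb: "orbit q x = F (orbit p x)" if x: "x \<in> S" for x
  proof (cases "b \<in> orbit p x")
    case False
    have sub: "orbit p x \<subseteq> S"
      using permutes_orbit_subset[OF assms(1) x] .
    have "orbit q x = orbit p x"
    proof (rule orbit_cong)
      show "x \<in> orbit p x"
        using assms(1,2) by (intro permutation_self_in_orbit) (auto simp: permutation_permutes)
      show "q s = p s" if "s \<in> orbit p x" for s
      proof -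
        have "p s \<noteq> b"
          using orbit.step[OF that] False by auto
        then show ?thesis using qS that sub by auto
      qed
    qed
    then show ?thesis using False by (simp add: F_def)
  next
    case True
    have sub: "orbit p x \<subseteq> S"
      using permutes_orbit_subset[OF assms(1) x] .
    have step: "p y \<in> orbit q x" if "q y \<in> orbit q x" "y \<in> S" for y
    proof (cases "p y = b")
      case True
      then have "a \<in> orbit q x"
        using that qS by simp
      then show ?thesis
        using orbit.step[of a q x] qa True by simp
    qed (use that qS in auto)
    have 1: "y \<in> orbit q x" if "y \<in> orbit p x" for y
      using that
    proof induction
      case base
      show ?case using step[OF orbit.base x] .
    next
      case (step y)
      then show ?case
        using \<open>\<And>y. q y \<in> orbit q x \<Longrightarrow> y \<in> S \<Longrightarrow> p y \<in> orbit q x\<close> sub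
        by (auto intro: orbit.step)
    qed
    have "a \<in> orbit q x"
      using True
    proof (cases rule: orbit.cases)
      case base
      then show ?thesis using orbit.base[of q x] qS[OF x] by simp
    next
      case (step y)
      then show ?thesis using orbit.step[OF 1[of y]] qS[of y] sub by auto
    qed
    moreover have "y \<in> insert a (orbit p x)" if "y \<in> orbit q x" for y
      using that
    proof induction
      case base
      show ?case using qS[OF x] by (auto intro: orbit.base)
    next
      case (step y)
      show ?case
      proof (cases "y = a")
        case True
        then show ?thesis using qa \<open>b \<in> orbit p x\<close> by simp
      next
        case False
        then have "y \<in> orbit p x" using step.IH by simp
        moreover from this have "y \<in> S" using sub by blast
        ultimately show ?thesis using qS[of y] orbit.step[of y p x] by simp
      qed
    qed
    ultimately show ?thesis using True 1 by (auto simp: F_def)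
  qed
  have "orbit q a = orbit q b"
    using permutation_orbit_step[OF perm, of a] qa by simp
  then have "orbit q ` insert a S = orbit q ` S"
    using assms(4) by auto
  also have "\<dots> = F ` (orbit p ` S)"
    using orb by (auto simp: image_iff)
  finally have "card (orbit q ` insert a S) = card (F ` (orbit p ` S))" by simp
  also have "\<dots> = card (orbit p ` S)"
  proof (rule card_image, rule inj_onI)
    fix X Y assume XY: "X \<in> orbit p ` S" "Y \<in> orbit p ` S" "F X = F Y"
    then have "a \<notin> X" "a \<notin> Y"
      using permutes_orbit_subset[OF assms(1)] assms(3) by blast+
    with XY(3) show "X = Y"
      by (auto simp: F_def split: if_splits)
  qed
  finally show ?thesis unfolding q_def .
qed

lemma card_permutes_orbits_insert:
  fixes S :: "'a set"
  assumes "finite S" "a \<notin> S"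
  defines "P \<equiv> (\<lambda>S k. {p :: 'a \<Rightarrow> 'a. p permutes S \<and> card (orbit p ` S) = k})"
  shows "card (P (insert a S) (Suc k)) = card S * card (P S (Suc k)) + card (P S k)"
proof -
  define h where "h = (\<lambda>(b, p :: 'a \<Rightarrow> 'a). transpose a b \<circ> p)"
  have fin: "finite (P S j)" for j
    using finite_permutations[OF assms(1)] by (auto simp: P_def intro: finite_subset)
  have "P (insert a S) (Suc k) = h ` (S \<times> P S (Suc k) \<union> {a} \<times> P S k)" (is "?L = ?R")
  proof (intro set_eqI iffI)
    fix q assume "q \<in> ?L"
    then have q: "q \<in> {q. q permutes insert a S}" and c: "card (orbit q ` insert a S) = Suc k"
      by (auto simp: P_def)
    from q obtain b p where bp: "b \<in> insert a S" "p permutes S" "q = transpose a b \<circ> p"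
      unfolding permutes_insert by auto
    show "q \<in> ?R"
    proof (cases "b = a")
      case True
      with bp c have "p \<in> P S k" "q = h (a, p)"
        using card_orbits_fixpoint[OF bp(2) assms(1,2)] by (auto simp: P_def h_def)
      then show ?thesis by blast
    next
      case False
      with bp c have "b \<in> S" "p \<in> P S (Suc k)" "q = h (b, p)"
        using card_orbits_insert[OF bp(2) assms(1,2)] by (auto simp: P_def h_def)
      then show ?thesis by blast
    qed
  next
    fix q assume "q \<in> ?R"
    then obtain b p where bp: "q = transpose a b \<circ> p"
      and *: "b \<in> S \<and> p \<in> P S (Suc k) \<or> b = a \<and> p \<in> P S k"
      by (auto simp: h_def)
    then have p: "p permutes S" "b \<in> insert a S" by (auto simp: P_def)
    then have "q \<in> {q. q permutes insert a S}"
      unfolding permutes_insert using bp by auto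
    then have "q permutes insert a S" by simp
    moreover have "card (orbit q ` insert a S) = Suc k"
      using * card_orbits_fixpoint[OF p(1) assms(1,2)] card_orbits_insert[OF p(1) assms(1,2), of b]
      by (auto simp: P_def bp)
    ultimately show "q \<in> ?L" by (simp add: P_def)
  qed
  moreover have "inj_on h (S \<times> P S (Suc k) \<union> {a} \<times> P S k)"
  proof (rule inj_onI)
    fix x y
    assume x: "x \<in> S \<times> P S (Suc k) \<union> {a} \<times> P S k"
      and y: "y \<in> S \<times> P S (Suc k) \<union> {a} \<times> P S k" and eq: "h x = h y"
    obtain b p c r where xy: "x = (b, p)" "y = (c, r)" by (cases x, cases y)
    have "p permutes S" "r permutes S"
      using x y xy by (auto simp: P_def)
    then have "p a = a" "r a = a"
      using assms(2) by (auto simp: permutes_not_in)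
    then have "b = c"
      using fun_cong[OF eq, of a] by (simp add: h_def xy)
    moreover from this have "transpose a b \<circ> (transpose a b \<circ> p) = transpose a b \<circ> (transpose a b \<circ> r)"
      using eq by (simp add: h_def xy)
    then have "p = r" by (simp add: o_assoc)
    ultimately show "x = y" by (simp add: xy)
  qed
  ultimately have "card (P (insert a S) (Suc k)) = card (S \<times> P S (Suc k) \<union> {a} \<times> P S k)"
    by (simp add: card_image)
  also have "\<dots> = card (S \<times> P S (Suc k)) + card ({a} \<times> P S k)"
    using assms fin by (intro card_Un_disjoint) auto
  finally show ?thesis by (simp add: card_cartesian_product)
qed

theorem C_eq_stirling: "C m k = stirling m k"
proof (induction m k rule: stirling.induct)
  case 1
  have "{p :: nat \<Rightarrow> nat. p permutes {}} = {id}" by auto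
  then show ?case by (simp add: C_def)
next
  case (2 k)
  then show ?case by (simp add: C_def)
next
  case (3 m)
  then show ?case by (simp add: C_def)
next
  case (4 m k)
  have "{1..Suc m} = insert (Suc m) {1..m}" by auto
  then show ?case
    using card_permutes_orbits_insert[of "{1..m}" "Suc m" k] 4
    by (simp add: C_def)
qed

end

theory Submission
  imports Defs "HOL-Computational_Algebra.Polynomial"
begin

text \<open>
  Write \<open>N = n + 1\<close> and \<open>P\<^sub>N(x) = x (x + 1) \<cdots> (x + N - 1)\<close>, whose coefficients are the numbers
  \<open>C(N, j)\<close>. The product \<open>(x + 1) \<cdots> (x + N - 2)\<close> divides all of \<open>P\<^sub>N(x \<plusminus> 1)\<close>, \<open>P\<^sub>N(x)\<close>
  and \<open>P\<^sub>N\<^sub>-\<^sub>1(x)\<close>, and comparing cofactors gives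
  \<open>x (P\<^sub>N(x + 1) - P\<^sub>N(x - 1)) = 2 N P\<^sub>N(x) - N (N - 1) P\<^sub>N\<^sub>-\<^sub>1(x)\<close>.
  The identity is the comparison of the coefficients of \<open>x\<^sup>k\<close>: on the left the central difference
  keeps only the \<open>C(N, j)\<close> with \<open>j - k\<close> even, and the term \<open>j = k\<close> contributes \<open>2 k C(N, k)\<close>.
\<close>

lemma pochhammer_central_difference:
  fixes x :: "'a :: comm_ring_1"
  assumes "n \<ge> 1"
  shows "x * (pochhammer (x + 1) (Suc n) - pochhammer (x - 1) (Suc n)) =
    2 * of_nat (Suc n) * pochhammer x (Suc n) - of_nat (Suc n) * of_nat n * pochhammer x n"
proof -
  obtain m where n: "n = Suc m" using assms by (cases n) auto
  define Q where "Q = pochhammer (x + 1) m"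
  have "pochhammer (x + 1) (Suc n) = Q * (x + 1 + of_nat m) * (x + 2 + of_nat m)"
    by (simp add: n Q_def pochhammer_Suc algebra_simps)
  moreover have "pochhammer (x - 1) (Suc n) = (x - 1) * (x * Q)"
    unfolding n Q_def by (simp add: pochhammer_rec)
  moreover have "pochhammer x n = x * Q"
    unfolding n Q_def by (simp add: pochhammer_rec)
  moreover from this have "pochhammer x (Suc n) = x * Q * (x + 1 + of_nat m)"
    by (simp add: pochhammer_Suc n algebra_simps)
  \<comment> \<open>With \<open>x * Q\<close> factored out, what remains is (x + m + 1)(x + m + 2) -
    x (x - 1) = 2 (m + 2)(x + m + 1) - (m + 2)(m + 1).\<close>
  ultimately show ?thesis
    by (simp only:) (simp add: n algebra_simps)
qed

text \<open>By the binomial theorem the coefficient is (j choose r) (1 - (-1)^(j - r)), so the even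
  differences cancel and the odd ones double.\<close>

lemma coeff_central_difference_power:
  "coeff ([:1, 1:] ^ j - [:-1, 1:] ^ j :: 'a :: comm_ring_1 poly) r =
    (if r \<le> j \<and> odd (j - r) then 2 * of_nat (j choose r) else 0)"
proof (cases "r \<le> j")
  case True
  then show ?thesis by (auto simp: coeff_linear_poly_power)
next
  case False
  have "degree ([:c, 1:] ^ j :: 'a poly) < r" for c
    using degree_power_le[of "[:c, 1:]" j] False by simp
  then show ?thesis using False by (simp add: coeff_eq_0)
qed

text \<open>Half the coefficient of x^(r + 1) in \<open>pochhammer_central_difference\<close>, taken
  at the polynomial x. The factor x in front of the difference shifts the index, so the left side
  uses r and the right side \<open>Suc r\<close>.\<close>

lemma sum_stirling_central_difference:
  assumes "n \<ge> 1"
  shows "(\<Sum>j\<le>Suc n. if r \<le> j \<and> odd (j - r)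
      then real (j choose r) * real (stirling (Suc n) j) else 0) =
    real (Suc n) * real (stirling (Suc n) (Suc r)) - real (Suc n choose 2) * real (stirling n (Suc r))"
proof -
  let ?X = "[:0, 1:] :: real poly"
  let ?D = "pochhammer (?X + 1) (Suc n) - pochhammer (?X - 1) (Suc n)"
  have coeff_X: "coeff (pochhammer ?X m) k = real (stirling m k)" for m k
  proof -
    have "pochhammer ?X m = (\<Sum>j\<le>m. monom (real (stirling m j)) j)"
      by (simp flip: stirling_pochhammer add: of_nat_poly monom_altdef)
    then show ?thesis by (simp add: coeff_sum not_le)
  qed
  have "?X + 1 = [:1, 1:]" "?X - 1 = [:-1, 1:]"
    by (simp_all add: one_pCons)
  then have "?D = (\<Sum>j\<le>Suc n. of_nat (stirling (Suc n) j) * ([:1, 1:] ^ j - [:-1, 1:] ^ j))"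
    by (simp only: stirling_pochhammer[symmetric] right_diff_distrib sum_subtractf)
  then have coeff_D: "coeff ?D r =
      2 * (\<Sum>j\<le>Suc n. if r \<le> j \<and> odd (j - r)
        then real (j choose r) * real (stirling (Suc n) j) else 0)"
    unfolding sum_distrib_left
    by (simp only: coeff_sum of_nat_poly mult_pCons_left coeff_central_difference_power)
       (auto intro!: sum.cong simp: coeff_central_difference_power simp del: coeff_diff sum.atMost_Suc)
  have "coeff ?D r = coeff (?X * ?D) (Suc r)"
    by simp
  also have "\<dots> =
      2 * (real (Suc n) * real (stirling (Suc n) (Suc r)) -
      real (Suc n choose 2) * real (stirling n (Suc r)))"
  proof -
    have "real (Suc n) * real n = 2 * real (Suc n choose 2)"
      by (simp add: choose_two real_of_nat_div algebra_simps)
    moreover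
    have "?X * ?D = smult (2 * real (Suc n)) (pochhammer ?X (Suc n)) -
        smult (real (Suc n) * real n) (pochhammer ?X n)"
      unfolding pochhammer_central_difference[OF assms]
      by (simp add: of_nat_poly numeral_poly mult.commute del: of_nat_Suc)
    ultimately show ?thesis
      by (simp only: coeff_diff coeff_smult coeff_X right_diff_distrib mult.assoc)
  qed
  finally show ?thesis
    unfolding coeff_D by (simp only: mult_cancel_left) simp
qed

text \<open>Substitute j = r + 1 + 2 i. Letting i run up to n reaches every such j up to n, and any
  larger j falls where f vanishes.\<close>

lemma sum_if_odd_diff:
  fixes f :: "nat \<Rightarrow> 'a :: comm_monoid_add"
  assumes "\<And>j. j > n \<Longrightarrow> f j = 0"
  shows "(\<Sum>j\<le>n. if r \<le> j \<and> odd (j - r) then f j else 0) = (\<Sum>i\<le>n. f (Suc r + 2 * i))"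
proof -
  have "(\<Sum>j\<le>n. if r \<le> j \<and> odd (j - r) then f j else 0) =
      (\<Sum>j\<in>(\<lambda>i. Suc r + 2 * i) ` {..n}. f j)"
  proof (rule sum.mono_neutral_cong)
    fix j assume j: "j \<in> {..n} - (\<lambda>i. Suc r + 2 * i) ` {..n}"
    have False if "r \<le> j" "odd (j - r)"
    proof -
      from that obtain i where "j - r = 2 * i + 1" by (elim oddE)
      with that have "j = Suc r + 2 * i" by simp
      with j show False by auto
    qed
    then show "(if r \<le> j \<and> odd (j - r) then f j else 0) = 0" by auto
  qed (use assms in auto)
  also have "\<dots> = (\<Sum>i\<le>n. f (Suc r + 2 * i))"
    by (subst sum.reindex) (auto simp: inj_on_def)
  finally show ?thesis .
qed

theorem theorem3:
  fixes n k :: nat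
  assumes "n \<ge> 1" and "k \<ge> 1" and "k \<noteq> n + 1"
  shows "real (C (n + 1) k) =
    (\<Sum>\<^sub>\<infinity>i\<in>{1..}. real ((k + 2 * i) choose (k - 1)) * (real (C (n + 1) (k + 2 * i)) / (real n + 1 - real k)))
    + real ((n + 1) choose 2) * (real (C n k) / (real n + 1 - real k))"
proof -
  obtain r where k: "k = Suc r" using assms by (cases k) auto
  define d where "d = real n + 1 - real k"
  have d: "d \<noteq> 0" using assms unfolding d_def by linarith
  define f where "f j = real (j choose r) * real (stirling (Suc n) j)" for j
  \<comment> \<open>The series is a finite sum: for i > n + 1 the index k + 2 i exceeds n + 1, and
    the Stirling number is 0.\<close>
  have "(\<Sum>\<^sub>\<infinity>i\<in>{1..}. real ((k + 2 * i) choose (k - 1)) * (real (C (n + 1) (k + 2 * i)) / d)) =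
      (\<Sum>\<^sub>\<infinity>i\<in>{1..Suc n}. f (k + 2 * i) / d)"
    by (rule infsum_cong_neutral) (auto simp: f_def k C_eq_stirling)
  also have "\<dots> = (\<Sum>i\<in>{1..Suc n}. f (k + 2 * i)) / d"
    by (simp add: sum_divide_distrib del: sum.cl_ivl_Suc)
  finally have inf: "(\<Sum>\<^sub>\<infinity>i\<in>{1..}. real ((k + 2 * i) choose (k - 1)) * (real (C (n + 1) (k + 2 * i)) / d)) =
      (\<Sum>i\<in>{1..Suc n}. f (k + 2 * i)) / d" .
  have "{..Suc n} = insert 0 {1..Suc n}" by auto
  then have "f k + (\<Sum>i\<in>{1..Suc n}. f (k + 2 * i)) = (\<Sum>i\<le>Suc n. f (Suc r + 2 * i))"
    by (simp add: k del: sum.cl_ivl_Suc)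
  also have "\<dots> = (\<Sum>j\<le>Suc n. if r \<le> j \<and> odd (j - r) then f j else 0)"
    by (rule sum_if_odd_diff[symmetric]) (simp add: f_def)
  also have "\<dots> = real (Suc n) * real (C (n + 1) k) - real (Suc n choose 2) * real (C n k)"
    unfolding f_def sum_stirling_central_difference[OF assms(1)] by (simp add: k C_eq_stirling)
  \<comment> \<open>The term i = 0 is f k = k C(n + 1, k), since (k choose k - 1) = k. Moved to the
    right, it turns the factor n + 1 into d.\<close>
  finally have "(\<Sum>i\<in>{1..Suc n}. f (k + 2 * i)) + real ((n + 1) choose 2) * real (C n k) =
      d * real (C (n + 1) k)"
    by (simp add: f_def k d_def C_eq_stirling algebra_simps del: sum.cl_ivl_Suc)
  then have "real (C (n + 1) k) =
      ((\<Sum>i\<in>{1..Suc n}. f (k + 2 * i)) + real ((n + 1) choose 2) * real (C n k)) / d"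
    using d by simp
  then show ?thesis
    unfolding d_def[symmetric] inf by (simp add: add_divide_distrib)
qed

end
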